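(* Let $\Omega_i=\mathbb{R}^{m_i}$, $i=1,2,3$. Let $\operatorname{conv}(W^{2d})$ be locally strictly convex at $(u^{1d},u^{2d},u^{3d})$ and assume that $J_2$ is Fréchet differentiable at $(u^{1d},u^{2d},u^{3d})$. If $(u^{1d},u^{2d},u^{3d})$ is an exposed point of $\operatorname{conv}(W^{2d})$ and $\nabla_{u^1}J_2(u^{1d},u^{2d},u^{3d})\ne 0$, then there exists an affine map $\gamma^1:\Omega_2\times\Omega_3\to\Omega_1$ (of the leader) that realizes the desired equilibrium $(u^{1d},u^{2d},u^{3d})$.
   Context: Trilevel static game: the leader, the middle level player and the follower choose $u^1\in\Omega_1$, $u^2\in\Omega_2$, $u^3\in\Omega_3$ respectively, where $\Omega_i=\mathbb{R}^{m_i}$, $m_i\ge 1$, and minimize cost functions $J_1,J_2,J_3:\Omega_1\times\Omega_2\times\Omega_3\to\mathbb{R}$ respectively. $J_1$ is assumed to have a unique global minimizer $(u^{1d},u^{2d},u^{3d})$, called the desired equilibrium. Sublevel set: $W^{2d}=\{(u^1,u^2,u^3): J_2(u^1,u^2,u^3)\le J_2(u^{1d},u^{2d},u^{3d})\}$ (not assumed convex); $W^{2d}$ and the analogous set $W^{3d}=\{(u^1,u^2,u^3): J_3(u^1,u^2,u^3)\le J_3(u^{1d},u^{2d},u^{3d})\}$ are assumed connected. $\operatorname{conv}$ denotes the convex hull. A point $x$ of a convex set $K$ is exposed if there is a supporting hyperplane of $K$ meeting $K$ only at $x$. Strategy classes: $\Gamma^1$ is the set of affine maps $\gamma^1:\Omega_2\times\Omega_3\to\Omega_1$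 with $\gamma^1(u^{2d},u^{3d})=u^{1d}$; $\Gamma^2$ is the set of affine maps $\gamma^2:\Omega_3\to\Omega_2$ with $\gamma^2(u^{3d})=u^{2d}$. Condition (L) on $\gamma^1\in\Gamma^1$: $(u^{2d},u^{3d})$ is the unique minimizer of $(u^2,u^3)\mapsto J_2(\gamma^1(u^2,u^3),u^2,u^3)$ over $\Omega_2\times\Omega_3$. Condition (M) on a pair $\gamma^1\in\Gamma^1,\gamma^2\in\Gamma^2$: $u^{3d}$ is the unique minimizer of $u^3\mapsto J_3(\gamma^1(\gamma^2(u^3),u^3),\gamma^2(u^3),u^3)$ over $\Omega_3$. The map $\gamma^1$ realizes the desired equilibrium if $\gamma^1\in\Gamma^1$, (L) holds, and there is $\gamma^2\in\Gamma^2$ such that (M) holds. Standing assumption (A): for every $\gamma^1\in\Gamma^1$ satisfying (L) there is $\gamma^2\in\Gamma^2$ such that (M) holds. A set $W$ is locally strictly convex at a point $x\in W$ if $x$ is a boundary point of $W$ and there is a neighbourhood $U$ of $x$ such that for every $y\in W\cap U$, $y\ne x$, the open segment between $x$ and $y$ lies in the interior of $W$. *)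

theory Defs
  imports "HOL-Analysis.Analysis"
begin

definition unique_minimizer :: "('a \<Rightarrow> real) \<Rightarrow> 'a \<Rightarrow> bool" where
  "unique_minimizer f x \<longleftrightarrow>
     is_arg_min f (\<lambda>_. True) x \<and> (\<forall>y. is_arg_min f (\<lambda>_. True) y \<longrightarrow> y = x)"

definition sublevel_set :: "('a \<Rightarrow> real) \<Rightarrow> 'a \<Rightarrow> 'a set" where
  "sublevel_set J p = {u. J u \<le> J p}"

text \<open>
  A supporting hyperplane has a nonzero normal vector, whereas
  \<^const>\<open>exposed_face_of\<close> also admits the zero vector.
\<close>

definition exposed_point :: "'a::real_inner \<Rightarrow> 'a set \<Rightarrow> bool" where
  "exposed_point x K \<longleftrightarrow>
     (\<exists>a b. a \<noteq> 0 \<and> K \<subseteq> {y. a \<bullet> y \<le> b} \<and> K \<inter> {y. a \<bullet> y = b} = {x})"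

definition locally_strictly_convex_at :: "'a::real_normed_vector set \<Rightarrow> 'a \<Rightarrow> bool" where
  "locally_strictly_convex_at W x \<longleftrightarrow>
     x \<in> W \<and> x \<in> frontier W \<and>
     (\<exists>U. open U \<and> x \<in> U \<and>
        (\<forall>y \<in> W \<inter> U. y \<noteq> x \<longrightarrow> open_segment x y \<subseteq> interior W))"

definition affine_map :: "('a::real_vector \<Rightarrow> 'b::real_vector) \<Rightarrow> bool" where
  "affine_map f \<longleftrightarrow> (\<exists>L c. linear L \<and> f = (\<lambda>x. L x + c))"

text \<open>
  Below, \<open>d1\<close>, \<open>d2\<close>, \<open>d3\<close> are the components of the desired equilibrium.
\<close>

definition Gamma1 ::
  "'a::real_vector \<Rightarrow> 'b::real_vector \<Rightarrow> 'c::real_vector \<Rightarrow> ('b \<times> 'c \<Rightarrow> 'a) set" where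
  "Gamma1 d1 d2 d3 = {\<gamma>1. affine_map \<gamma>1 \<and> \<gamma>1 (d2, d3) = d1}"

definition Gamma2 :: "'b::real_vector \<Rightarrow> 'c::real_vector \<Rightarrow> ('c \<Rightarrow> 'b) set" where
  "Gamma2 d2 d3 = {\<gamma>2. affine_map \<gamma>2 \<and> \<gamma>2 d3 = d2}"

definition condition_L ::
  "('a \<times> 'b \<times> 'c \<Rightarrow> real) \<Rightarrow> 'b \<Rightarrow> 'c \<Rightarrow> ('b \<times> 'c \<Rightarrow> 'a) \<Rightarrow> bool" where
  "condition_L J2 d2 d3 \<gamma>1 \<longleftrightarrow>
     unique_minimizer (\<lambda>(u2, u3). J2 (\<gamma>1 (u2, u3), u2, u3)) (d2, d3)"

definition condition_M ::
  "('a \<times> 'b \<times> 'c \<Rightarrow> real) \<Rightarrow> 'c \<Rightarrow> ('b \<times> 'c \<Rightarrow> 'a) \<Rightarrow> ('c \<Rightarrow> 'b) \<Rightarrow> bool" where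
  "condition_M J3 d3 \<gamma>1 \<gamma>2 \<longleftrightarrow>
     unique_minimizer (\<lambda>u3. J3 (\<gamma>1 (\<gamma>2 u3, u3), \<gamma>2 u3, u3)) d3"

definition realizes_desired_equilibrium ::
  "('a::real_vector \<times> 'b::real_vector \<times> 'c::real_vector \<Rightarrow> real) \<Rightarrow> ('a \<times> 'b \<times> 'c \<Rightarrow> real)
    \<Rightarrow> 'a \<Rightarrow> 'b \<Rightarrow> 'c \<Rightarrow> ('b \<times> 'c \<Rightarrow> 'a) \<Rightarrow> bool" where
  "realizes_desired_equilibrium J2 J3 d1 d2 d3 \<gamma>1 \<longleftrightarrow>
     \<gamma>1 \<in> Gamma1 d1 d2 d3 \<and> condition_L J2 d2 d3 \<gamma>1 \<and>
     (\<exists>\<gamma>2 \<in> Gamma2 d2 d3. condition_M J3 d3 \<gamma>1 \<gamma>2)"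

end

theory Submission
  imports Defs
begin

text \<open>
  The sublevel set of \<open>J2\<close> lies in the half-space bounded by a hyperplane \<open>H\<close> that meets it only at the
  desired equilibrium. Directions of descent at that point lead into the sublevel set, so the normal
  of \<open>H\<close> is not orthogonal to any direction in which the derivative of \<open>J2\<close> is nonzero; in particular
  its \<open>u1\<close>-component does not vanish. Hence \<open>H\<close> contains the graph of an affine map over
  \<open>(u2, u3)\<close>, and \<open>J2\<close> exceeds its desired value everywhere else on that graph.
\<close>

text \<open>Along the ray \<open>p + t *\<^sub>R h\<close> the function \<open>J\<close> has slope
  \<open>D h\<close> at \<open>t = 0\<close>, so it drops below \<open>J p\<close> for all small
  positive \<open>t\<close>.\<close>

lemma descent_direction_enters_sublevel_set:
  fixes J :: "'a::real_normed_vector \<Rightarrow> real"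
  assumes "(J has_derivative D) (at p)" and "D h < 0"
  obtains t where "t > 0" and "p + t *\<^sub>R h \<in> sublevel_set J p"
proof -
  interpret D: bounded_linear D
    using assms(1) by (rule has_derivative_bounded_linear)
  have "(J has_derivative D) (at (p + 0 *\<^sub>R h))"
    using assms(1) by simp
  moreover have "((\<lambda>t. p + t *\<^sub>R h) has_derivative (\<lambda>t. t *\<^sub>R h)) (at 0)"
    by (auto intro!: derivative_eq_intros)
  ultimately have "((\<lambda>t. J (p + t *\<^sub>R h)) has_derivative (\<lambda>t. D (t *\<^sub>R h))) (at 0)"
    using has_derivative_compose by blast
  then have "((\<lambda>t. J (p + t *\<^sub>R h)) has_real_derivative D h) (at 0)"
    by (simp add: has_field_derivative_def D.scaleR mult_commute_abs)
  from DERIV_neg_dec_right[OF this assms(2)]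
  obtain d where "d > 0" and d: "\<And>t. 0 < t \<Longrightarrow> t < d \<Longrightarrow> J (p + t *\<^sub>R h) < J p"
    by auto
  then have "p + (d / 2) *\<^sub>R h \<in> sublevel_set J p"
    using d[of "d / 2"] unfolding sublevel_set_def by (auto intro!: less_imp_le)
  then show thesis
    using that[of "d / 2"] \<open>d > 0\<close> by simp
qed

text \<open>If \<open>a\<close> were orthogonal to \<open>e\<close>, adding multiples of
  \<open>e\<close> to the outward direction \<open>a\<close> would change its derivative at will but
  not its inner product with \<open>a\<close>. Some direction would then be both outward and of
  descent.\<close>

lemma supporting_normal_not_orthogonal:
  fixes J :: "'a::real_inner \<Rightarrow> real"
  assumes deriv: "(J has_derivative D) (at p)"
    and supp: "sublevel_set J p \<subseteq> {y. a \<bullet> y \<le> a \<bullet> p}"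
    and "a \<noteq> 0" and "D e \<noteq> 0"
  shows "a \<bullet> e \<noteq> 0"
proof
  assume "a \<bullet> e = 0"
  interpret D: bounded_linear D
    using deriv by (rule has_derivative_bounded_linear)
  \<comment> \<open>The coefficient of \<open>e\<close> is chosen so that
    \<open>D h = -1\<close>.\<close>
  define h where "h = a - ((D a + 1) / D e) *\<^sub>R e"
  have "D h < 0"
    using \<open>D e \<noteq> 0\<close> by (simp add: h_def D.diff D.scaleR)
  with deriv obtain t where "t > 0" and "p + t *\<^sub>R h \<in> sublevel_set J p"
    by (rule descent_direction_enters_sublevel_set)
  then have "t * (a \<bullet> h) \<le> 0"
    using supp by (auto simp: inner_add_right)
  moreover have "a \<bullet> h = a \<bullet> a"
    using \<open>a \<bullet> e = 0\<close> by (simp add: h_def inner_diff_right)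
  ultimately show False
    using \<open>t > 0\<close> \<open>a \<noteq> 0\<close> by (metis inner_gt_zero_iff mult_pos_pos not_le)
qed

lemma partial_has_derivative:
  assumes "(J has_derivative D) (at (x, y))"
  shows "((\<lambda>u. J (u, y)) has_derivative (\<lambda>h. D (h, 0))) (at x)"
proof -
  have "((\<lambda>u. (u, y)) has_derivative (\<lambda>h. (h, 0))) (at x)"
    by (auto intro!: derivative_eq_intros)
  from has_derivative_compose[OF this assms] show ?thesis .
qed

lemma unique_minimizerI:
  assumes "\<And>y. y \<noteq> x \<Longrightarrow> f x < f y"
  shows "unique_minimizer f x"
  unfolding unique_minimizer_def is_arg_min_def
  using assms by (metis less_asym)

lemma hyperplane_contains_affine_graph:
  fixes a1 d1 :: "'a::real_inner" and a2 d2 :: "'b::real_inner"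
  assumes "a1 \<noteq> 0"
  obtains \<gamma> where "affine_map \<gamma>" and "\<gamma> d2 = d1"
    and "\<And>x. (a1, a2) \<bullet> (\<gamma> x, x) = (a1, a2) \<bullet> (d1, d2)"
proof
  \<comment> \<open>Scaling \<open>a1\<close> this way gives
    \<open>a1 \<bullet> L x = - (a2 \<bullet> x)\<close>, so every \<open>(L x, x)\<close> is
    orthogonal to \<open>(a1, a2)\<close>. The constant in \<open>\<gamma>\<close> then moves the
    graph through \<open>(d1, d2)\<close>.\<close>
  define L where "L = (\<lambda>x. (- (a2 \<bullet> x) / (a1 \<bullet> a1)) *\<^sub>R a1)"
  define \<gamma> where "\<gamma> = (\<lambda>x. L x + (d1 - L d2))"
  have "linear L"
    by (rule linearI)
       (simp_all add: L_def inner_add_right add_divide_distrib scaleR_left_distrib)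
  then show "affine_map \<gamma>"
    unfolding affine_map_def \<gamma>_def by blast
  show "\<gamma> d2 = d1"
    by (simp add: \<gamma>_def)
  show "(a1, a2) \<bullet> (\<gamma> x, x) = (a1, a2) \<bullet> (d1, d2)" for x
    using assms by (simp add: \<gamma>_def L_def inner_add_right inner_diff_right)
qed

theorem proposition3p14:
  fixes J1 J2 J3 :: "(real ^ 'm1) \<times> (real ^ 'm2) \<times> (real ^ 'm3) \<Rightarrow> real"
    and u1d :: "real ^ 'm1" and u2d :: "real ^ 'm2" and u3d :: "real ^ 'm3"
    and g :: "real ^ 'm1"
  assumes "unique_minimizer J1 (u1d, u2d, u3d)"
    and "connected (sublevel_set J2 (u1d, u2d, u3d))"
    and "connected (sublevel_set J3 (u1d, u2d, u3d))"
    and "\<forall>\<gamma>1 \<in> Gamma1 u1d u2d u3d. condition_L J2 u2d u3d \<gamma>1 \<longrightarrow>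
           (\<exists>\<gamma>2 \<in> Gamma2 u2d u3d. condition_M J3 u3d \<gamma>1 \<gamma>2)"
    and "locally_strictly_convex_at (convex hull (sublevel_set J2 (u1d, u2d, u3d))) (u1d, u2d, u3d)"
    and "J2 differentiable at (u1d, u2d, u3d)"
    and "exposed_point (u1d, u2d, u3d) (convex hull (sublevel_set J2 (u1d, u2d, u3d)))"
    and "GDERIV (\<lambda>u1. J2 (u1, u2d, u3d)) u1d :> g" and "g \<noteq> 0"
  shows "\<exists>\<gamma>1. affine_map \<gamma>1 \<and> realizes_desired_equilibrium J2 J3 u1d u2d u3d \<gamma>1"
proof -
  let ?p = "(u1d, u2d, u3d)"
  let ?W = "sublevel_set J2 ?p"
  obtain a b where "a \<noteq> 0" and supp: "convex hull ?W \<subseteq> {y. a \<bullet> y \<le> b}"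
    and touch: "convex hull ?W \<inter> {y. a \<bullet> y = b} = {?p}"
    using assms(7) unfolding exposed_point_def by blast
  have W: "?W \<subseteq> convex hull ?W"
    by (rule hull_subset)
  have b: "b = a \<bullet> ?p"
    using touch by auto
  obtain a1 a2 where a: "a = (a1, a2)"
    by (cases a)
  obtain D where D: "(J2 has_derivative D) (at ?p)"
    using assms(6) unfolding differentiable_def by blast
  have "((\<lambda>u1. J2 (u1, u2d, u3d)) has_derivative (\<lambda>h. h \<bullet> g)) (at u1d)"
    using assms(8) by (simp add: gderiv_def)
  \<comment> \<open>The partial gradient \<open>g\<close> represents \<open>D\<close> on the
    \<open>u1\<close>-directions, whence \<open>D (g, 0) = g \<bullet> g\<close>.\<close>
  then have "(\<lambda>h. D (h, 0)) = (\<lambda>h. h \<bullet> g)"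
    using partial_has_derivative[OF D] has_derivative_unique by blast
  then have "D (g, 0) \<noteq> 0"
    using assms(9) by (metis inner_eq_zero_iff)
  with D \<open>a \<noteq> 0\<close> have "a \<bullet> (g, 0) \<noteq> 0"
    using supp W b by (intro supporting_normal_not_orthogonal[of J2 D ?p]) auto
  \<comment> \<open>Here \<open>a \<bullet> (g, 0)\<close> is just
    \<open>a1 \<bullet> g\<close>.\<close>
  then have "a1 \<noteq> 0"
    by (auto simp: a)
  then obtain \<gamma> where \<gamma>: "affine_map \<gamma>" "\<gamma> (u2d, u3d) = u1d"
    and graph: "\<And>x. a \<bullet> (\<gamma> x, x) = b"
    unfolding b a using hyperplane_contains_affine_graph[of a1 "(u2d, u3d)" u1d a2] by metis
  \<comment> \<open>A graph point with value at most \<open>J2 ?p\<close> would lie in both the hull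
    and the hyperplane, which share only \<open>?p\<close>.\<close>
  have less: "J2 ?p < J2 (\<gamma> x, x)" if "x \<noteq> (u2d, u3d)" for x
  proof (rule ccontr)
    assume "\<not> J2 ?p < J2 (\<gamma> x, x)"
    then have "(\<gamma> x, x) \<in> convex hull ?W"
      using W by (auto simp: sublevel_set_def)
    then have "(\<gamma> x, x) = ?p"
      using touch graph by blast
    with that show False
      by simp
  qed
  have "condition_L J2 u2d u3d \<gamma>"
    unfolding condition_L_def by (rule unique_minimizerI) (use less \<gamma>(2) in auto)
  moreover have "\<gamma> \<in> Gamma1 u1d u2d u3d"
    using \<gamma> by (simp add: Gamma1_def)
  \<comment> \<open>The standing assumption (A) turns (L) for \<open>\<gamma>\<close> into a
    suitable strategy of the middle player.\<close>
  ultimately show ?thesis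
    using assms(4) \<gamma>(1) unfolding realizes_desired_equilibrium_def by blast
qed

end
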